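(* Let $p\in(0,1)$. Any one-sided e-statistic for $\mathrm{VaR}_p$ is bounded above by $$e'(x,r)=1+h(r)\,\frac{p-\mathbf 1_{\{x\le r\}}}{1-p},\qquad x,r\in\mathbb R,$$ for some function $h$ on $\mathbb R$ with $0\le h\le 1$. The upper bound $e'$ is a one-sided e-statistic for $\mathrm{VaR}_p$. Moreover, $e'$ is a backtest e-statistic for $\mathrm{VaR}_p$ if and only if $h>0$. The function $h$ is constant if and only if $e'$ is a monotone backtest e-statistic for $\mathrm{VaR}_p$.
   Context: $\mathcal M_0$ is the set of all distributions on $\mathbb R$ (identified with distribution functions), and $\mathrm{VaR}_p(F)=\inf\{x\in\mathbb R:F(x)\ge p\}$ for $F\in\mathcal M_0$. A measurable function $e:\mathbb R^2\to[0,\infty]$ is a one-sided e-statistic for a functional $\rho:\mathcal M_0\to\mathbb R$ if $\int e(x,r)\,\mathrm dF(x)\le1$ for each $F\in\mathcal M_0$ and each $r\ge\rho(F)$. A one-sided e-statistic is a backtest e-statistic for $\rho$ if $\int e(x,r)\,\mathrm dF(x)>1$ for all $r\in\rho(\mathcal M_0)$ and all $F\in\mathcal M_0$ with $\rho(F)>r$. A backtest e-statistic is monotone if, in addition, $r\mapsto e(x,r)$ is decreasing (in the weak sense) for each $x$.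
   Formalization: In the last claim "h is constant" is read as "h is constant and positive", since h = 0 gives e' = 1, not a backtest e-statistic; and h is taken Borel measurable (the bounding h is proved to be so), since otherwise e' is not measurable and not an e-statistic. *)

theory Defs
  imports "HOL-Probability.Probability"
begin

definition distributions :: "real measure set" where
  "distributions = {F. real_distribution F}"

(* For F in distributions and 0 < p < 1 the set below is nonempty and bounded below,
   so that Inf on the reals is the genuine infimum. *)
definition VaR :: "real \<Rightarrow> real measure \<Rightarrow> real" where
  "VaR p F = Inf {x. p \<le> cdf F x}"

definition one_sided_e_statistic ::
  "(real measure \<Rightarrow> real) \<Rightarrow> (real \<Rightarrow> real \<Rightarrow> ennreal) \<Rightarrow> bool" where
  "one_sided_e_statistic \<rho> e \<longleftrightarrow>
     (\<lambda>(x, r). e x r) \<in> borel_measurable borel \<and>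
     (\<forall>F\<in>distributions. \<forall>r\<ge>\<rho> F. (\<integral>\<^sup>+ x. e x r \<partial>F) \<le> 1)"

definition backtest_e_statistic ::
  "(real measure \<Rightarrow> real) \<Rightarrow> (real \<Rightarrow> real \<Rightarrow> ennreal) \<Rightarrow> bool" where
  "backtest_e_statistic \<rho> e \<longleftrightarrow>
     one_sided_e_statistic \<rho> e \<and>
     (\<forall>r\<in>\<rho> ` distributions. \<forall>F\<in>distributions. r < \<rho> F \<longrightarrow> 1 < (\<integral>\<^sup>+ x. e x r \<partial>F))"

definition monotone_backtest_e_statistic ::
  "(real measure \<Rightarrow> real) \<Rightarrow> (real \<Rightarrow> real \<Rightarrow> ennreal) \<Rightarrow> bool" where
  "monotone_backtest_e_statistic \<rho> e \<longleftrightarrow>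
     backtest_e_statistic \<rho> e \<and> (\<forall>x. antimono (\<lambda>r. e x r))"

(* For 0 < p < 1 and 0 \<le> h r \<le> 1 the real argument of ennreal is nonnegative (it is 1 - h r
   for x \<le> r and at least 1 for x > r), so the coercion does not truncate. *)
definition e_bound :: "real \<Rightarrow> (real \<Rightarrow> real) \<Rightarrow> real \<Rightarrow> real \<Rightarrow> ennreal" where
  "e_bound p h x r = ennreal (1 + h r * ((p - indicator {..r} x) / (1 - p)))"

end

(* The two-point law with mass p at x and 1 - p at y has VaR at most r when x <= r, so any one-sided
   e-statistic satisfies p * e(x, r) + (1 - p) * e(y, r) <= 1 for x <= r < y. Hence, for each r, some
   h(r) in [0, 1] bounds e(x, r) by 1 - h(r) for x <= r and e(y, r) by 1 + h(r) p / (1 - p) for y > r.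
   Since the suprema of e over x and over y need not be Borel functions of r, measurability of h is
   the delicate point: for each level c, the sets of r forcing h(r) > c and h(r) < c are disjoint
   projections of Borel sets, so Lusin's theorem separates them by a Borel set C(c), and h(r) is the
   supremum of the rational c with r in C(c). *)
theory Submission imports Defs
begin

section \<open>Borel separation and Lusin's theorem\<close>

text \<open>One Borel set serves both sides, because its complement covers \<open>B\<close>.\<close>

definition borel_separated :: "'a::topological_space set \<Rightarrow> 'a set \<Rightarrow> bool" where
  "borel_separated A B \<longleftrightarrow> (\<exists>C\<in>sets borel. A \<subseteq> C \<and> C \<inter> B = {})"

text \<open>For fixed \<open>i\<close>, intersecting the separators over \<open>j\<close> gives a
  Borel set around \<open>A i\<close> that misses every \<open>B j\<close>; then unite over
  \<open>i\<close>. In contrapositive form, an inseparable pair cut into countably many pieces has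
  an inseparable pair of pieces.\<close>

lemma borel_separated_UN:
  fixes A B :: "nat \<Rightarrow> 'a::topological_space set"
  assumes "\<And>i j. borel_separated (A i) (B j)"
  shows "borel_separated (\<Union>i. A i) (\<Union>j. B j)"
proof -
  obtain C where C: "\<And>i j. C i j \<in> sets borel" "\<And>i j. A i \<subseteq> C i j" "\<And>i j. C i j \<inter> B j = {}"
    using assms unfolding borel_separated_def by metis
  show ?thesis
    unfolding borel_separated_def
  proof (intro bexI[of _ "\<Union>i. \<Inter>j. C i j"] conjI)
    show "(\<Union>i. \<Inter>j. C i j) \<in> sets borel"
      by (intro sets.countable_UN sets.countable_INT subsetI) (auto simp: C(1))
    show "(\<Union>i. A i) \<subseteq> (\<Union>i. \<Inter>j. C i j)" using C(2) by blast
    show "(\<Union>i. \<Inter>j. C i j) \<inter> (\<Union>j. B j) = {}" using C(3) by blast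
  qed
qed

lemma borel_separated_empty: "borel_separated {} B" "borel_separated A {}"
  unfolding borel_separated_def by (auto intro: bexI[of _ "{}"] bexI[of _ UNIV])

text \<open>The centres run through a countable dense set. Closed balls are chosen so that cutting a
  closed set by them leaves it closed.\<close>

lemma polish_cover_cball:
  assumes "0 < \<epsilon>"
  obtains d :: "nat \<Rightarrow> 'a::{complete_space, second_countable_topology}" where "(\<Union>n. cball (d n) \<epsilon>) = UNIV"
proof -
  obtain D :: "'a set" where D: "countable D" "\<And>X. open X \<Longrightarrow> X \<noteq> {} \<Longrightarrow> \<exists>d\<in>D. d \<in> X"
    by (rule countable_dense_setE) blast
  have "D \<noteq> {}" using D(2)[of UNIV] by auto
  have "x \<in> (\<Union>n. cball (from_nat_into D n) \<epsilon>)" for x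
  proof -
    obtain d where "d \<in> D" "d \<in> ball x \<epsilon>" using D(2)[of "ball x \<epsilon>"] assms by auto
    moreover from \<open>d \<in> D\<close> obtain n where "from_nat_into D n = d"
      using D(1) from_nat_into_surj by metis
    ultimately show ?thesis by (auto simp: dist_commute intro!: exI[of _ n])
  qed
  then show ?thesis using that by blast
qed

lemma cball_dist_le:
  fixes x y :: "'a::metric_space"
  assumes "x \<in> cball z \<epsilon>" "y \<in> cball z \<epsilon>"
  shows "dist x y \<le> 2 * \<epsilon>"
  using assms dist_triangle3[of x y z] by simp

text \<open>If the images were inseparable, repeated cutting would give nested inseparable pairs of
  closed sets of vanishing diameter. Completeness yields common points \<open>s\<close> and
  \<open>t\<close> with \<open>f s \<noteq> g t\<close>, and by continuity disjoint neighbourhoods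
  of these values separate the images of a late pair.\<close>

lemma lusin_separation:
  fixes f :: "'a::{complete_space, second_countable_topology} \<Rightarrow> 'c::t2_space" and g :: "'b::{complete_space, second_countable_topology} \<Rightarrow> 'c"
  assumes cl: "closed F" "closed G" and cont: "continuous_on UNIV f" "continuous_on UNIV g"
    and disj: "f ` F \<inter> g ` G = {}"
  shows "borel_separated (f ` F) (g ` G)"
proof (rule ccontr)
  assume neg: "\<not> ?thesis"
  define bad where "bad = (\<lambda>(S, T). closed S \<and> closed T \<and> S \<subseteq> F \<and> T \<subseteq> G \<and> \<not> borel_separated (f ` S) (g ` T))"
  have refine: "\<exists>S' T'. bad (S', T') \<and> S' \<subseteq> S \<and> T' \<subseteq> T \<and>
      (\<forall>x\<in>S'. \<forall>y\<in>S'. dist x y \<le> 2 * \<epsilon>) \<and> (\<forall>x\<in>T'. \<forall>y\<in>T'. dist x y \<le> 2 * \<epsilon>)"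
    if bad: "bad (S, T)" and "0 < \<epsilon>" for S T \<epsilon>
  proof -
    obtain c :: "nat \<Rightarrow> 'a" where c: "(\<Union>n. cball (c n) \<epsilon>) = UNIV"
      using polish_cover_cball \<open>0 < \<epsilon>\<close> by blast
    obtain d :: "nat \<Rightarrow> 'b" where d: "(\<Union>n. cball (d n) \<epsilon>) = UNIV"
      using polish_cover_cball \<open>0 < \<epsilon>\<close> by blast
    have *: "f ` S = (\<Union>i. f ` (S \<inter> cball (c i) \<epsilon>))" "g ` T = (\<Union>i. g ` (T \<inter> cball (d i) \<epsilon>))"
      using c d by blast+
    obtain i j where "\<not> borel_separated (f ` (S \<inter> cball (c i) \<epsilon>)) (g ` (T \<inter> cball (d j) \<epsilon>))"
        using bad borel_separated_UN[of "\<lambda>i. f ` (S \<inter> cball (c i) \<epsilon>)" "\<lambda>j. g ` (T \<inter> cball (d j) \<epsilon>)"]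
      unfolding bad_def *[symmetric] by auto
    then show ?thesis
      using bad
      by (intro exI[of _ "S \<inter> cball (c i) \<epsilon>"] exI[of _ "T \<inter> cball (d j) \<epsilon>"])
         (auto simp: bad_def simp del: mem_cball intro: cball_dist_le)
  qed
  \<comment> \<open>Both sets are carried in one pair, since dependent choice must refine them
    simultaneously; stage \<open>n\<close> cuts by balls of radius
    \<open>inverse (Suc n)\<close>.\<close>
  have "\<exists>P. \<forall>n::nat. bad (P n) \<and> (fst (P (Suc n)) \<subseteq> fst (P n) \<and> snd (P (Suc n)) \<subseteq> snd (P n) \<and>
      (\<forall>x\<in>fst (P (Suc n)). \<forall>y\<in>fst (P (Suc n)). dist x y \<le> 2 * inverse (Suc n)) \<and>
      (\<forall>x\<in>snd (P (Suc n)). \<forall>y\<in>snd (P (Suc n)). dist x y \<le> 2 * inverse (Suc n)))"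
  proof (intro dependent_nat_choice)
    show "\<exists>P. bad P" using neg cl by (auto simp: bad_def)
    show "\<exists>Q. bad Q \<and> (fst Q \<subseteq> fst P \<and> snd Q \<subseteq> snd P \<and>
      (\<forall>x\<in>fst Q. \<forall>y\<in>fst Q. dist x y \<le> 2 * inverse (Suc n)) \<and>
      (\<forall>x\<in>snd Q. \<forall>y\<in>snd Q. dist x y \<le> 2 * inverse (Suc n)))" if "bad P" for P n
      using refine[of "fst P" "snd P" "inverse (Suc n)"] that by force
  qed
  then obtain P where P: "\<And>n. bad (P n)"
      "\<And>n. fst (P (Suc n)) \<subseteq> fst (P n)" "\<And>n. snd (P (Suc n)) \<subseteq> snd (P n)"
      "\<And>n x y. x \<in> fst (P (Suc n)) \<Longrightarrow> y \<in> fst (P (Suc n)) \<Longrightarrow> dist x y \<le> 2 * inverse (Suc n)"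
      "\<And>n x y. x \<in> snd (P (Suc n)) \<Longrightarrow> y \<in> snd (P (Suc n)) \<Longrightarrow> dist x y \<le> 2 * inverse (Suc n)"
    by blast
  define S T where "S n = fst (P n)" and "T n = snd (P n)" for n
  have dec: "antimono S" "antimono T"
    using P(2,3) by (auto simp: decseq_Suc_iff S_def T_def)
  have cl': "closed (S n)" "closed (T n)" for n
    using P(1)[of n] by (auto simp: bad_def S_def T_def split: prod.splits)
  have bad': "\<not> borel_separated (f ` S n) (g ` T n)" for n
    using P(1)[of n] by (auto simp: bad_def S_def T_def split: prod.splits)
  \<comment> \<open>An empty set is separated from anything, so inseparable pieces are
    nonempty.\<close>
  have ne: "S n \<noteq> {}" "T n \<noteq> {}" for n
    using bad'[of n] by (auto simp: borel_separated_empty)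
  have small: "\<exists>n. (\<forall>x\<in>S n. \<forall>y\<in>S n. dist x y < \<epsilon>) \<and> (\<forall>x\<in>T n. \<forall>y\<in>T n. dist x y < \<epsilon>)"
    if \<epsilon>: "0 < \<epsilon>" for \<epsilon>
  proof -
    obtain n where "inverse (Suc n) < \<epsilon> / 2"
      using reals_Archimedean[of "\<epsilon> / 2"] \<epsilon> by auto
    then have "2 * inverse (Suc n) < \<epsilon>" by simp
    then show ?thesis
      using P(4,5)[where n=n] unfolding S_def T_def by (meson le_less_trans)
  qed
  obtain s where s: "\<And>n. s \<in> S n"
    using decreasing_closed_nest[of S] cl' ne dec small unfolding antimono_def by metis
  obtain t where t: "\<And>n. t \<in> T n"
    using decreasing_closed_nest[of T] cl' ne dec small unfolding antimono_def by metis
  have "S 0 \<subseteq> F" "T 0 \<subseteq> G"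
    using P(1)[of 0] by (auto simp: bad_def S_def T_def split: prod.splits)
  then have "f s \<noteq> g t" using s[of 0] t[of 0] disj by blast
  then obtain U V where UV: "open U" "open V" "f s \<in> U" "g t \<in> V" "U \<inter> V = {}"
    using hausdorff[of "f s" "g t"] by auto
  have "open (f -` U)" "open (g -` V)" 
    using cont UV(1,2) by (simp_all add: open_vimage)
  then obtain \<delta>1 \<delta>2 where \<delta>: "0 < \<delta>1" "ball s \<delta>1 \<subseteq> f -` U" "0 < \<delta>2" "ball t \<delta>2 \<subseteq> g -` V"
    using UV(3,4) by (meson open_contains_ball vimage_eq)
  obtain n where n: "\<forall>x\<in>S n. \<forall>y\<in>S n. dist x y < min \<delta>1 \<delta>2" "\<forall>x\<in>T n. \<forall>y\<in>T n. dist x y < min \<delta>1 \<delta>2"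
    using small[of "min \<delta>1 \<delta>2"] \<delta> by auto
  have "S n \<subseteq> ball s \<delta>1" "T n \<subseteq> ball t \<delta>2"
    using n s t by auto
  then have "f ` S n \<subseteq> U" "g ` T n \<subseteq> V"
    using \<delta> by blast+
  \<comment> \<open>The open set \<open>U\<close> is itself the Borel separator.\<close>
  then have "borel_separated (f ` S n) (g ` T n)"
    using UV unfolding borel_separated_def by (intro bexI[of _ U]) auto
  with bad' show False by blast
qed

(* Projections along the Baire space; the type discrete supplies the metric that nat lacks. *)
definition analytic :: "'a::topological_space set \<Rightarrow> bool" where
  "analytic A \<longleftrightarrow> (\<exists>F :: ('a \<times> (nat \<Rightarrow> nat discrete)) set. closed F \<and> A = fst ` F)"

section \<open>Closure properties of analytic sets, and separation of Borel projections\<close>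

lemma analytic_closed: "closed A \<Longrightarrow> analytic A"
  unfolding analytic_def by (intro exI[of _ "A \<times> UNIV"]) (auto intro: closed_Times)

text \<open>The first coordinate of the Baire sequence names the index \<open>n\<close>, and its
  tail, read off by \<open>\<phi>\<close>, is the witness for \<open>A n\<close>.\<close>

lemma analytic_UN:
  fixes A :: "nat \<Rightarrow> 'a::topological_space set"
  assumes "\<And>n. analytic (A n)"
  shows "analytic (\<Union>n. A n)"
proof -
  obtain F :: "nat \<Rightarrow> ('a \<times> (nat \<Rightarrow> nat discrete)) set"
    where F: "\<And>n. closed (F n)" "\<And>n. A n = fst ` F n"
    using assms unfolding analytic_def by metis
  define \<phi> :: "'a \<times> (nat \<Rightarrow> nat discrete) \<Rightarrow> 'a \<times> (nat \<Rightarrow> nat discrete)"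
    where "\<phi> = (\<lambda>(x, s). (x, \<lambda>k. s (Suc k)))"
  define G where "G = {z. \<phi> z \<in> F (of_discrete (snd z 0))}"
  have cont: "continuous_on UNIV \<phi>"
    unfolding \<phi>_def case_prod_unfold
    by (intro continuous_on_Pair continuous_on_coordinatewise_then_product continuous_on_fst continuous_on_id)
       (rule continuous_on_product_then_coordinatewise, intro continuous_intros)
  \<comment> \<open>Fixing a discrete coordinate is an open condition, so splitting by the value of
    that coordinate shows the complement of \<open>G\<close> to be open.\<close>
  have "- G = (\<Union>n. (\<lambda>z. snd z 0) -` {discrete n} \<inter> \<phi> -` (- F n))"
    by (auto simp: G_def discrete_inverse) (metis of_discrete_inverse)
  moreover have "open ((\<lambda>z::'a \<times> (nat \<Rightarrow> nat discrete). snd z 0) -` {discrete n} \<inter> \<phi> -` (- F n))" for n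
  proof (rule open_Int)
    show "open ((\<lambda>z::'a \<times> (nat \<Rightarrow> nat discrete). snd z 0) -` {discrete n})"
      by (rule open_vimage[OF open_discrete continuous_on_product_then_coordinatewise])
         (intro continuous_intros)
    show "open (\<phi> -` (- F n))"
      using F(1) cont by (intro open_vimage) auto
  qed
  ultimately have "closed G" unfolding closed_def by (simp add: open_UN)
  moreover have "(\<Union>n. A n) = fst ` G"
  proof (intro equalityI subsetI)
    fix x assume "x \<in> (\<Union>n. A n)"
    then obtain n s where "(x, s) \<in> F n" by (auto simp: F(2))
    then have "(x, case_nat (discrete n) s) \<in> G" by (simp add: G_def \<phi>_def discrete_inverse)
    then show "x \<in> fst ` G" by force
  next
    fix x assume "x \<in> fst ` G"
    then show "x \<in> (\<Union>n. A n)" by (force simp: G_def \<phi>_def F(2))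
  qed
  ultimately show ?thesis unfolding analytic_def by blast
qed

text \<open>A single Baire sequence codes countably many through \<open>prod_encode\<close>;
  \<open>\<phi> n\<close> reads row \<open>n\<close>, the witness for \<open>A n\<close>.\<close>

lemma analytic_INT:
  fixes A :: "nat \<Rightarrow> 'a::topological_space set"
  assumes "\<And>n. analytic (A n)"
  shows "analytic (\<Inter>n. A n)"
proof -
  obtain F :: "nat \<Rightarrow> ('a \<times> (nat \<Rightarrow> nat discrete)) set"
    where F: "\<And>n. closed (F n)" "\<And>n. A n = fst ` F n"
    using assms unfolding analytic_def by metis
  define \<phi> :: "nat \<Rightarrow> 'a \<times> (nat \<Rightarrow> nat discrete) \<Rightarrow> 'a \<times> (nat \<Rightarrow> nat discrete)"
    where "\<phi> n = (\<lambda>(x, s). (x, \<lambda>k. s (prod_encode (n, k))))" for n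
  define G where "G = (\<Inter>n. \<phi> n -` F n)"
  have cont: "continuous_on UNIV (\<phi> n)" for n
    unfolding \<phi>_def case_prod_unfold
    by (intro continuous_on_Pair continuous_on_coordinatewise_then_product continuous_on_fst continuous_on_id)
       (rule continuous_on_product_then_coordinatewise, intro continuous_intros)
  have "closed G"
    unfolding G_def using F(1) cont by (auto intro!: closed_INT closed_vimage)
  moreover have "(\<Inter>n. A n) = fst ` G"
  proof (intro equalityI subsetI)
    fix x assume "x \<in> (\<Inter>n. A n)"
    then have "\<forall>n. \<exists>s. (x, s) \<in> F n" by (force simp: F(2))
    then obtain s where s: "\<And>n. (x, s n) \<in> F n" by metis
    then have "(x, \<lambda>m. case prod_decode m of (n, k) \<Rightarrow> s n k) \<in> G"
      by (simp add: G_def \<phi>_def)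
    then show "x \<in> fst ` G" by force
  next
    fix x assume "x \<in> fst ` G"
    then show "x \<in> (\<Inter>n. A n)" by (force simp: G_def \<phi>_def F(2))
  qed
  ultimately show ?thesis unfolding analytic_def by blast
qed

text \<open>An open set of a metric space is a countable union of closed sets: the points at
  distance at least \<open>inverse (Suc n)\<close> from the complement.\<close>

lemma analytic_open:
  fixes A :: "'a::metric_space set"
  assumes "open A"
  shows "analytic A"
\<comment> \<open>\<open>infdist\<close> to the empty set is 0 by convention, so the distance
  description fails for the whole space.\<close>
proof (cases "A = UNIV")
  case False
  have "A = (\<Union>n. {x. inverse (Suc n) \<le> infdist x (- A)})"
  proof (intro equalityI subsetI)
    fix x assume "x \<in> A"
    then have "0 < infdist x (- A)"
      using assms False by (intro infdist_pos_not_in_closed) auto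
    then show "x \<in> (\<Union>n. {x. inverse (Suc n) \<le> infdist x (- A)})"
      using reals_Archimedean less_imp_le by blast
  next
    fix x assume "x \<in> (\<Union>n. {x. inverse (Suc n) \<le> infdist x (- A)})"
    then have "infdist x (- A) > 0"
      by (auto intro: less_le_trans[rotated])
    then show "x \<in> A" by (metis ComplI infdist_zero less_irrefl)
  qed
  also have "analytic \<dots>"
    by (intro analytic_UN analytic_closed closed_Collect_le continuous_intros)
  finally show ?thesis .
qed (simp add: analytic_closed)

lemma analytic_borel:
  fixes A :: "'a::metric_space set"
  assumes "A \<in> sets borel"
  shows "analytic A"
proof -
  \<comment> \<open>Analyticity does not pass to complements in general, so the induction carries a
    set and its complement together; complements of unions use \<open>analytic_INT\<close>.\<close>
  have "analytic A \<and> analytic (- A)"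
    using assms unfolding sets_borel
  proof (induction rule: sigma_sets.induct)
    case (Basic a)
    then show ?case by (simp add: analytic_open analytic_closed closed_Compl)
  next
    case Empty
    then show ?case by (simp add: analytic_closed)
  next
    case (Compl a)
    then show ?case by (simp add: Compl_eq_Diff_UNIV[symmetric])
  next
    case (Union a)
    then show ?case by (simp add: analytic_UN analytic_INT)
  qed
  then show ?thesis ..
qed

text \<open>Each projection is the image under \<open>snd\<close> after \<open>fst\<close> of a
  closed set in the product with the Baire space, so Lusin's theorem applies.\<close>

lemma borel_separated_snd:
  fixes A B :: "('a::{complete_space, second_countable_topology} \<times> 'b::{complete_space, second_countable_topology}) set"
  assumes "A \<in> sets borel" "B \<in> sets borel" "snd ` A \<inter> snd ` B = {}"
  shows "borel_separated (snd ` A) (snd ` B)"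
proof -
  obtain F G :: "(('a \<times> 'b) \<times> (nat \<Rightarrow> nat discrete)) set"
    where FG: "closed F" "A = fst ` F" "closed G" "B = fst ` G"
    using analytic_borel[OF assms(1)] analytic_borel[OF assms(2)] unfolding analytic_def by blast
  have "borel_separated ((\<lambda>z. snd (fst z)) ` F) ((\<lambda>z. snd (fst z)) ` G)"
    using FG assms(3) by (intro lusin_separation continuous_intros) (auto simp: image_image)
  then show ?thesis by (simp add: FG image_image)
qed

section \<open>Value at Risk and two-point laws\<close>

text \<open>Right-continuity of the cdf makes the infimum attained. Through this equivalence,
  statements about \<open>VaR\<close> become statements about one value of the cdf.\<close>

lemma VaR_le_iff:
  assumes "F \<in> distributions" "0 < p" "p < 1"
  shows "VaR p F \<le> r \<longleftrightarrow> p \<le> cdf F r"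
proof -
  interpret cdf_distribution F
    using assms(1) by (simp add: distributions_def cdf_distribution_def)
  show ?thesis
    unfolding VaR_def by (rule pseudoinverse[OF assms(2,3), symmetric])
qed

definition two_point :: "real \<Rightarrow> real \<Rightarrow> real \<Rightarrow> real measure" where
  "two_point p x y = distr (measure_pmf (bernoulli_pmf p)) borel (\<lambda>b. if b then x else y)"

lemma two_point_distribution: "two_point p x y \<in> distributions"
  unfolding two_point_def distributions_def
  by (simp add: prob_space.real_distribution_distr measure_pmf.prob_space_axioms)

lemma nn_integral_two_point:
  assumes "0 \<le> p" "p \<le> 1" "f \<in> borel_measurable borel"
  shows "(\<integral>\<^sup>+ z. f z \<partial>two_point p x y) = f x * ennreal p + f y * ennreal (1 - p)"
  using assms by (simp add: two_point_def nn_integral_distr)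

lemma cdf_two_point:
  assumes "0 \<le> p" "p \<le> 1"
  shows "cdf (two_point p x y) r = p * indicator {..r} x + (1 - p) * indicator {..r} y"
proof -
  have "emeasure (two_point p x y) {..r} = (\<integral>\<^sup>+ z. indicator {..r} z \<partial>two_point p x y)"
    by (simp add: two_point_def)
  also have "\<dots> = ennreal (p * indicator {..r} x + (1 - p) * indicator {..r} y)"
    using assms by (subst nn_integral_two_point) (auto simp: indicator_def simp flip: ennreal_plus)
  finally show ?thesis
    using assms by (simp add: cdf_def measure_def del: ennreal_plus)
qed

lemma VaR_two_point_le:
  assumes "0 < p" "p < 1" "x \<le> r"
  shows "VaR p (two_point p x y) \<le> r"
  unfolding VaR_le_iff[OF two_point_distribution assms(1,2)]
  using assms by (simp add: cdf_two_point)

text \<open>With equal atoms the law is a point mass. Hence every real is a value of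
  \<open>VaR p\<close>, as the backtest condition asks of its \<open>r\<close>.\<close>

lemma VaR_two_point_same:
  assumes "0 < p" "p < 1"
  shows "VaR p (two_point p x x) = x"
proof -
  have "VaR p (two_point p x x) \<le> r \<longleftrightarrow> x \<le> r" for r
    unfolding VaR_le_iff[OF two_point_distribution assms]
    using assms by (cases "x \<le> r") (simp_all add: cdf_two_point)
  from this[of x] this[of "VaR p (two_point p x x)"] show ?thesis by simp
qed

section \<open>Properties of the upper bound\<close>

lemma e_bound_measurable:
  assumes "h \<in> borel_measurable borel"
  shows "(\<lambda>(x, r). e_bound p h x r) \<in> borel_measurable borel"
proof -
  \<comment> \<open>The indicator of a ray depending on \<open>r\<close> becomes that of a fixed
    closed half-plane, which gives joint measurability.\<close>
  have eq: "(\<lambda>(x, r). e_bound p h x r) = (\<lambda>z. ennreal (1 + h (snd z) *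
      ((p - indicator {z. fst z \<le> snd z} z) / (1 - p))))"
    by (auto simp: e_bound_def indicator_def fun_eq_iff)
  have [measurable]: "{z :: real \<times> real. fst z \<le> snd z} \<in> sets borel"
    by (intro borel_closed closed_Collect_le continuous_intros)
  have [measurable]: "(\<lambda>z::real \<times> real. h (snd z)) \<in> borel_measurable borel"
    by (rule measurable_compose[OF borel_measurable_continuous_onI assms]) (intro continuous_intros)
  show ?thesis unfolding eq by measurable
qed

lemma e_bound_le: "p < 1 \<Longrightarrow> x \<le> r \<Longrightarrow> e_bound p h x r = ennreal (1 - h r)"
  and e_bound_gt: "r < x \<Longrightarrow> e_bound p h x r = ennreal (1 + h r * (p / (1 - p)))"
proof -
  assume "p < 1" "x \<le> r"
  moreover from this have "(p - 1) / (1 - p) = - 1" by (simp add: divide_simps)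
  ultimately show "e_bound p h x r = ennreal (1 - h r)"
    by (simp add: e_bound_def del: times_divide_eq_right)
next
  assume "r < x"
  then show "e_bound p h x r = ennreal (1 + h r * (p / (1 - p)))"
    by (simp add: e_bound_def)
qed

text \<open>The integrand is affine in the indicator of \<open>{..r}\<close>, so integration
  replaces the indicator by \<open>cdf F r\<close>. The sign of \<open>p - cdf F r\<close> then
  governs the comparison with 1.\<close>

lemma nn_integral_e_bound:
  assumes "F \<in> distributions" "0 < p" "p < 1" "0 \<le> h r" "h r \<le> 1"
  shows "(\<integral>\<^sup>+ x. e_bound p h x r \<partial>F) = ennreal (1 + h r * ((p - cdf F r) / (1 - p)))"
proof -
  interpret real_distribution F
    using assms(1) by (simp add: distributions_def)
  \<comment> \<open>Nonnegativity rules out truncation by \<open>ennreal\<close>, so the integral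
    may be computed as a real one.\<close>
  have nonneg: "0 \<le> 1 + h r * ((p - indicator {..r} x) / (1 - p))" for x
  proof (cases "x \<le> r")
    case True
    have "(p - 1) / (1 - p) = - 1" using assms(3) by (simp add: divide_simps)
    with True show ?thesis using assms(5) by simp
  next
    case False
    then show ?thesis using assms by simp
  qed
  have int: "integrable F (\<lambda>x. indicator {..r} x :: real)"
    by (intro integrable_real_indicator) (auto simp: less_top[symmetric])
  have "(\<integral>\<^sup>+ x. e_bound p h x r \<partial>F) = ennreal (\<integral>x. 1 + h r * ((p - indicator {..r} x) / (1 - p)) \<partial>F)"
    unfolding e_bound_def using int nonneg
    by (intro nn_integral_eq_integral AE_I2) auto
  also have "(\<integral>x. 1 + h r * ((p - indicator {..r} x) / (1 - p)) \<partial>F) = 1 + h r * ((p - cdf F r) / (1 - p))"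
    using int by (simp add: cdf_def prob_space[simplified])
  finally show ?thesis .
qed

lemma e_bound_one_sided:
  assumes p: "0 < p" "p < 1" and h: "h \<in> borel_measurable borel" "\<And>r. 0 \<le> h r" "\<And>r. h r \<le> 1"
  shows "one_sided_e_statistic (VaR p) (e_bound p h)"
  unfolding one_sided_e_statistic_def
proof (intro conjI ballI allI impI)
  fix F r assume "F \<in> distributions" "VaR p F \<le> r"
  then have "h r * ((p - cdf F r) / (1 - p)) \<le> 0"
    using p h by (intro mult_nonneg_nonpos) (auto simp: VaR_le_iff divide_simps)
  then show "(\<integral>\<^sup>+ x. e_bound p h x r \<partial>F) \<le> 1"
    using p h \<open>F \<in> distributions\<close> by (simp add: nn_integral_e_bound)
qed (rule e_bound_measurable[OF h(1)])

text \<open>For necessity, the point mass at \<open>r + 1\<close> has cdf 0 at \<open>r\<close>, and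
  \<open>h r = 0\<close> would make its integral exactly 1. Conversely \<open>r < VaR p F\<close>
  means \<open>cdf F r < p\<close>, so a positive \<open>h r\<close> pushes the integral above
  1.\<close>

lemma e_bound_backtest_iff:
  assumes p: "0 < p" "p < 1" and h: "h \<in> borel_measurable borel" "\<And>r. 0 \<le> h r" "\<And>r. h r \<le> 1"
  shows "backtest_e_statistic (VaR p) (e_bound p h) \<longleftrightarrow> (\<forall>r. 0 < h r)"
proof
  assume bt: "backtest_e_statistic (VaR p) (e_bound p h)"
  show "\<forall>r. 0 < h r"
  proof
    fix r
    have "r \<in> VaR p ` distributions"
      by (metis VaR_two_point_same imageI p two_point_distribution)
    then have "1 < (\<integral>\<^sup>+ x. e_bound p h x r \<partial>two_point p (r + 1) (r + 1))"
      using bt two_point_distribution[of p "r + 1" "r + 1"] VaR_two_point_same[OF p, of "r + 1"]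
      unfolding backtest_e_statistic_def by (metis less_add_one)
    then have "h r \<noteq> 0"
      using p h by (auto simp: nn_integral_e_bound two_point_distribution)
    then show "0 < h r" using h(2)[of r] by simp
  qed
next
  assume pos: "\<forall>r. 0 < h r"
  have "1 < (\<integral>\<^sup>+ x. e_bound p h x r \<partial>F)" if "F \<in> distributions" "r < VaR p F" for F r
  proof -
    have "cdf F r < p"
      using VaR_le_iff[OF that(1) p] that(2) by (meson not_le)
    then have "0 < h r * ((p - cdf F r) / (1 - p))"
      using p pos by simp
    then show ?thesis
      using p h that(1) by (simp add: nn_integral_e_bound)
  qed
  then show "backtest_e_statistic (VaR p) (e_bound p h)"
    using e_bound_one_sided[OF p h] by (simp add: backtest_e_statistic_def)
qed

lemma e_bound_antimono_iff:
  assumes p: "0 < p" "p < 1" and h: "\<And>r. 0 \<le> h r" "\<And>r. h r \<le> 1"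
  shows "(\<forall>x. antimono (\<lambda>r. e_bound p h x r)) \<longleftrightarrow> h constant_on UNIV"
proof
  assume anti: "\<forall>x. antimono (\<lambda>r. e_bound p h x r)"
  have "h r = h s" if "r \<le> s" for r s
  proof -
    \<comment> \<open>The point \<open>r\<close> lies on the lower branch for both thresholds and
      yields \<open>h r \<le> h s\<close>; the point \<open>s + 1\<close> lies on the upper branch
      for both and yields the reverse.\<close>
    have "e_bound p h r s \<le> e_bound p h r r" "e_bound p h (s + 1) s \<le> e_bound p h (s + 1) r"
      using anti that by (auto dest: antimonoD)
    then have "h r \<le> h s \<and> h s * (p / (1 - p)) \<le> h r * (p / (1 - p))"
      using p h that by (simp add: e_bound_le e_bound_gt ennreal_le_iff add_nonneg_nonneg del: ennreal_plus times_divide_eq_right)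
    moreover have "0 < p / (1 - p)" using p by simp
    ultimately show ?thesis by (simp add: mult_le_cancel_right del: times_divide_eq_right)
  qed
  then show "h constant_on UNIV"
    unfolding constant_on_def by (intro exI[of _ "h 0"] ballI) (metis linear)
next
  assume "h constant_on UNIV"
  then obtain c where c: "\<And>r. h r = c" unfolding constant_on_def by auto
  then have "0 \<le> c" using h(1) by metis
  \<comment> \<open>For constant \<open>h\<close> only the indicator varies with \<open>r\<close>;
    it grows with \<open>r\<close> and enters with a nonpositive coefficient.\<close>
  then show "\<forall>x. antimono (\<lambda>r. e_bound p h x r)"
    using p unfolding antimono_def e_bound_def c
    by (intro allI impI ennreal_leI add_left_mono mult_left_mono divide_right_mono diff_left_mono)
       (auto simp: indicator_def)
qed

section \<open>Domination of arbitrary one-sided e-statistics\<close>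

lemma one_sided_e_statistic_section:
  assumes "one_sided_e_statistic \<rho> e"
  shows "(\<lambda>x. e x r) \<in> borel_measurable borel"
proof -
  have pair: "(\<lambda>x. (x, r)) \<in> borel \<rightarrow>\<^sub>M borel"
    by (intro borel_measurable_continuous_onI continuous_intros)
  have "(\<lambda>(x, r). e x r) \<in> borel_measurable borel"
    using assms by (simp add: one_sided_e_statistic_def)
  from measurable_compose[OF pair this] show ?thesis by simp
qed

text \<open>Together with joint measurability, this inequality is all that the domination argument
  uses of one-sidedness. The choice \<open>y = x\<close> bounds the left branch;
  \<open>y > r\<close> gives the trade-off between branches.\<close>

lemma one_sided_VaR_two_point:
  assumes p: "0 < p" "p < 1" and e: "one_sided_e_statistic (VaR p) e" and "x \<le> r"
  shows "e x r * ennreal p + e y r * ennreal (1 - p) \<le> 1"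
proof -
  have "(\<integral>\<^sup>+ z. e z r \<partial>two_point p x y) \<le> 1"
    using e VaR_two_point_le[OF p \<open>x \<le> r\<close>] two_point_distribution
    unfolding one_sided_e_statistic_def by blast
  then show ?thesis
    using p by (simp add: nn_integral_two_point one_sided_e_statistic_section[OF e])
qed

lemma one_sided_VaR_le_1:
  assumes p: "0 < p" "p < 1" and e: "one_sided_e_statistic (VaR p) e" and "x \<le> r"
  shows "e x r \<le> 1"
proof -
  have "1 = ennreal p + ennreal (1 - p)"
    using p ennreal_plus[of p "1 - p"] by (simp del: ennreal_plus)
  then have "e x r = e x r * (ennreal p + ennreal (1 - p))"
    by (metis mult.right_neutral)
  also have "\<dots> \<le> 1"
    using one_sided_VaR_two_point[OF assms, of x] by (simp only: distrib_left)
  finally show ?thesis .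
qed

text \<open>The first set forces \<open>h r > c\<close> and the second \<open>h r < c\<close>. A
  common \<open>r\<close> would violate the two-point inequality, so these projections of Borel sets
  are disjoint.\<close>

lemma one_sided_VaR_levels_separated:
  assumes p: "0 < p" "p < 1" and e: "one_sided_e_statistic (VaR p) e" and c: "0 \<le> c" "c \<le> 1"
  shows "borel_separated {r. \<exists>y>r. ennreal (1 + c * (p / (1 - p))) < e y r}
           {r. \<exists>x\<le>r. ennreal (1 - c) < e x r}"
proof -
  define E where "E = (\<lambda>(x, r). e x r)"
  have E: "E \<in> borel_measurable borel"
    using e by (simp add: one_sided_e_statistic_def E_def)
  define A B where "A = {z. snd z < fst z} \<inter> E -` {ennreal (1 + c * (p / (1 - p)))<..}"
    and "B = {z. fst z \<le> snd z} \<inter> E -` {ennreal (1 - c)<..}"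
  have "{z :: real \<times> real. snd z < fst z} \<in> sets borel"
    by (intro borel_open open_Collect_less continuous_intros)
  moreover have "{z :: real \<times> real. fst z \<le> snd z} \<in> sets borel"
    by (intro borel_closed closed_Collect_le continuous_intros)
  moreover have "E -` {a<..} \<in> sets borel" for a
    by (rule measurable_sets_borel[OF E]) simp
  ultimately have "A \<in> sets borel" "B \<in> sets borel"
    unfolding A_def B_def by (simp_all add: sets.Int)
  moreover have "snd ` A \<inter> snd ` B = {}"
  proof safe
    fix y r x s assume "(y, r) \<in> A" "(x, s) \<in> B" "snd (y, r) = snd (x, s)"
    then have *: "r < y" "x \<le> r" "ennreal (1 + c * (p / (1 - p))) < e y r" "ennreal (1 - c) < e x r"
      by (auto simp: A_def B_def E_def)
    \<comment> \<open>The thresholds are the two values of the bound at \<open>h r = c\<close>;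
      their mean with weights \<open>p\<close> and \<open>1 - p\<close> is 1.\<close>
    have "1 = ennreal ((1 - c) * p + (1 + c * (p / (1 - p))) * (1 - p))"
      using p by (simp add: field_simps)
    also have "\<dots> = ennreal (1 - c) * ennreal p + ennreal (1 + c * (p / (1 - p))) * ennreal (1 - p)"
      using p c by (subst ennreal_plus) (simp_all add: ennreal_mult[symmetric] del: ennreal_plus times_divide_eq_right)
    also have "\<dots> < e x r * ennreal p + e y r * ennreal (1 - p)"
      using * p by (intro add_strict_mono ennreal_mult_strict_right_mono) auto
    also have "\<dots> \<le> 1"
      by (rule one_sided_VaR_two_point[OF p e *(2)])
    finally show "snd (y, r) \<in> {}" by simp
  qed
  ultimately have "borel_separated (snd ` A) (snd ` B)"
    by (rule borel_separated_snd)
  moreover have "snd ` A = {r. \<exists>y>r. ennreal (1 + c * (p / (1 - p))) < e y r}"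
    "snd ` B = {r. \<exists>x\<le>r. ennreal (1 - c) < e x r}"
    by (auto simp: A_def B_def E_def image_iff Bex_def)
  ultimately show ?thesis by simp
qed

lemma one_sided_VaR_dominated:
  assumes p: "0 < p" "p < 1" and e: "one_sided_e_statistic (VaR p) e"
  obtains h :: "real \<Rightarrow> real" where "h \<in> borel_measurable borel" "\<And>r. 0 \<le> h r" "\<And>r. h r \<le> 1"
    "\<And>x r. e x r \<le> e_bound p h x r"
proof -
  define I :: "real set" where "I = \<rat> \<inter> {0..1}"
  have I: "countable I" "0 \<in> I" "1 \<in> I"
    by (auto simp: I_def countable_rat)
  have "\<forall>c\<in>I. \<exists>C. C \<in> sets borel \<and> {r. \<exists>y>r. ennreal (1 + c * (p / (1 - p))) < e y r} \<subseteq> C \<and>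
      C \<inter> {r. \<exists>x\<le>r. ennreal (1 - c) < e x r} = {}"
    using one_sided_VaR_levels_separated[OF p e] unfolding borel_separated_def I_def Bex_def by simp
  then obtain C where C_props: "\<forall>c\<in>I. C c \<in> sets borel \<and> {r. \<exists>y>r. ennreal (1 + c * (p / (1 - p))) < e y r} \<subseteq> C c \<and>
      C c \<inter> {r. \<exists>x\<le>r. ennreal (1 - c) < e x r} = {}"
    by (rule bchoice[THEN exE])
  have C: "C c \<in> sets borel" if "c \<in> I" for c
    using C_props that by simp
  have C_upper: "r \<in> C c" if "c \<in> I" "r < y" "ennreal (1 + c * (p / (1 - p))) < e y r" for c r y
    using C_props that by (auto simp del: times_divide_eq_right)
  have C_lower: "r \<notin> C c" if "c \<in> I" "x \<le> r" "ennreal (1 - c) < e x r" for c r x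
    using bspec[OF C_props that(1)] that(2,3) by blast
  \<comment> \<open>The indicator gives levels with \<open>r\<close> outside \<open>C c\<close> the
    value 0, so the supremum always runs over the same countable set and inherits Borel
    measurability.\<close>
  define h where "h r = (SUP c\<in>I. c * indicator (C c) r)" for r
  have bdd: "bdd_above ((\<lambda>c. c * indicator (C c) r) ` I)" for r
    by (intro bdd_aboveI[of _ 1]) (auto simp: I_def indicator_def)
  have h_lower: "c \<le> h r" if "c \<in> I" "r \<in> C c" for c r
    using cSUP_upper[OF that(1) bdd, of r] that(2) by (simp add: h_def)
  have h0: "0 \<le> h r" for r
    using cSUP_upper[OF I(2) bdd, of r] by (simp add: h_def)
  have h1: "h r \<le> 1" for r
    unfolding h_def using I(2) by (intro cSUP_least) (auto simp: I_def indicator_def)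
  have hm: "h \<in> borel_measurable borel"
    unfolding h_def using I(1) C bdd
    by (intro borel_measurable_cSUP borel_measurable_times borel_measurable_const borel_measurable_indicator) auto
  have "e x r \<le> e_bound p h x r" for x r
  proof (cases "x \<le> r")
    case True
    have "e x r \<le> ennreal (1 - h r)"
    proof (rule ccontr)
      assume "\<not> ?thesis"
      moreover obtain a where a: "0 \<le> a" "a \<le> 1" "e x r = ennreal a"
        using one_sided_VaR_le_1[OF p e True] by (cases "e x r") (auto simp: top_unique)
      ultimately have "1 - a < h r" using h1[of r] by (simp add: ennreal_le_iff)
      then obtain c where c: "c \<in> I" "1 - a < c * indicator (C c) r"
        unfolding h_def using I(2) bdd by (subst (asm) less_cSUP_iff) auto
      \<comment> \<open>Since \<open>1 - a\<close> is nonnegative, the indicator cannot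
        vanish.\<close>
      then have "r \<in> C c" "1 - a < c" using a(2) by (cases "r \<in> C c"; simp)+
      moreover from this have "ennreal (1 - c) < e x r"
        using a c(1) by (auto simp: I_def ennreal_less_iff)
      ultimately show False using C_lower[OF c(1) True] by blast
    qed
    then show ?thesis
      using True p by (simp add: e_bound_le)
  next
    case False
    have "e x r \<le> ennreal (1 + h r * (p / (1 - p)))"
    proof (rule ccontr)
      assume gt: "\<not> ?thesis"
      show False
      \<comment> \<open>At \<open>h r = 1\<close> no level in \<open>I\<close> lies above
        \<open>h r\<close>. The threshold there is \<open>1 / (1 - p)\<close>, which the two-point
        inequality with first atom \<open>r\<close> enforces directly.\<close>
      proof (cases "h r = 1")
        case True
        have "1 = ennreal (1 + h r * (p / (1 - p))) * ennreal (1 - p)"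
          using p True by (simp add: field_simps flip: ennreal_mult)
        also have "\<dots> < e x r * ennreal (1 - p)"
          using gt p by (intro ennreal_mult_strict_right_mono) auto
        also have "\<dots> \<le> e r r * ennreal p + e x r * ennreal (1 - p)" by simp
        also have "\<dots> \<le> 1" using one_sided_VaR_two_point[OF p e order.refl] .
        finally show False by simp
      next
        case False
        then have "h r < 1" using h1[of r] by simp
        have "e x r * ennreal (1 - p) \<le> 1"
          using one_sided_VaR_two_point[OF p e order.refl, of r x] by (rule order.trans[rotated]) simp
        then have "e x r \<noteq> \<top>" using p by (auto simp: ennreal_top_mult top_unique)
        then obtain a where a: "0 \<le> a" "e x r = ennreal a" by (cases "e x r") auto
        have "0 \<le> h r * (p / (1 - p))" using h0 p by simp
        then have "1 + h r * (p / (1 - p)) < a"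
          using gt a by (simp add: ennreal_le_iff del: ennreal_plus times_divide_eq_right)
        then have "h r < (a - 1) * (1 - p) / p"
          using p by (simp add: field_simps)
        \<comment> \<open>At the level \<open>(a - 1) * (1 - p) / p\<close> the upper threshold
          equals \<open>a\<close>; a rational strictly between it and \<open>h r\<close> forces
          \<open>r\<close> into \<open>C c\<close>. The minimum with 1 keeps \<open>c\<close> in
          \<open>I\<close>.\<close>
        then obtain c where c: "c \<in> \<rat>" "h r < c" "c < min 1 ((a - 1) * (1 - p) / p)"
          using Rats_dense_in_real[of "h r" "min 1 ((a - 1) * (1 - p) / p)"] \<open>h r < 1\<close> by auto
        then have "c \<in> I" using h0[of r] by (simp add: I_def)
        have "0 \<le> c * (p / (1 - p))" using c h0[of r] p by simp
        moreover have "1 + c * (p / (1 - p)) < a" using c(3) p by (simp add: field_simps)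
        ultimately have "ennreal (1 + c * (p / (1 - p))) < e x r"
          using a by (simp add: ennreal_less_iff del: ennreal_plus times_divide_eq_right)
        then have "c \<le> h r"
          using C_upper h_lower \<open>c \<in> I\<close> \<open>\<not> x \<le> r\<close> by (meson not_le)
        then show False using c(2) by simp
      qed
    qed
    then show ?thesis
      using False by (simp add: e_bound_gt)
  qed
  with hm h0 h1 show ?thesis by (rule that)
qed

text \<open>Constancy is paired with positivity in the last equivalence: for \<open>h\<close>
  identically 0 the bound is constantly 1, hence monotone but not a backtest e-statistic.\<close>

theorem theorem4:
  fixes p :: real
  assumes "0 < p" and "p < 1"
  shows "(\<forall>e. one_sided_e_statistic (VaR p) e \<longrightarrow>
           (\<exists>h :: real \<Rightarrow> real. h \<in> borel_measurable borel \<and> (\<forall>r. 0 \<le> h r \<and> h r \<le> 1) \<and>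
              (\<forall>x r. e x r \<le> e_bound p h x r))) \<and>
         (\<forall>h :: real \<Rightarrow> real. h \<in> borel_measurable borel \<and> (\<forall>r. 0 \<le> h r \<and> h r \<le> 1) \<longrightarrow>
           one_sided_e_statistic (VaR p) (e_bound p h) \<and>
           (backtest_e_statistic (VaR p) (e_bound p h) \<longleftrightarrow> (\<forall>r. 0 < h r)) \<and>
           (h constant_on UNIV \<and> (\<forall>r. 0 < h r) \<longleftrightarrow>
              monotone_backtest_e_statistic (VaR p) (e_bound p h)))"
proof (intro conjI[of "\<forall>e. _ e \<longrightarrow> _ e"] allI impI)
  fix e assume "one_sided_e_statistic (VaR p) e"
  from one_sided_VaR_dominated[OF assms this] show "\<exists>h :: real \<Rightarrow> real. h \<in> borel_measurable borel \<and>
      (\<forall>r. 0 \<le> h r \<and> h r \<le> 1) \<and> (\<forall>x r. e x r \<le> e_bound p h x r)"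
    by metis
next
  fix h :: "real \<Rightarrow> real" assume "h \<in> borel_measurable borel \<and> (\<forall>r. 0 \<le> h r \<and> h r \<le> 1)"
  then have h: "h \<in> borel_measurable borel" "\<And>r. 0 \<le> h r" "\<And>r. h r \<le> 1" by auto
  show "one_sided_e_statistic (VaR p) (e_bound p h) \<and>
           (backtest_e_statistic (VaR p) (e_bound p h) \<longleftrightarrow> (\<forall>r. 0 < h r)) \<and>
           (h constant_on UNIV \<and> (\<forall>r. 0 < h r) \<longleftrightarrow>
              monotone_backtest_e_statistic (VaR p) (e_bound p h))"
    using e_bound_one_sided[OF assms h] e_bound_backtest_iff[OF assms h]
      e_bound_antimono_iff[OF assms h(2,3)]
    by (auto simp: monotone_backtest_e_statistic_def)
qed

end
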